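(* Let $(\mathcal A,\mathcal A_0,(-))$ be a $\mathcal T$-semiring triple, with the relation $\preceq_0$, and let $A$ be an $n\times n$ matrix over $\mathcal A$. For any vector $\mathbf v\in\mathcal A^{(n)}$, the vector $\mathbf x=\operatorname{adj}(A)\mathbf v$ satisfies $|A|\mathbf v\preceq_0A\mathbf x$. In particular, if $|A|$ is tangible and invertible and $\operatorname{adj}(A)\mathbf v$ is tangible, then $\mathbf x:=\frac1{|A|}\operatorname{adj}(A)\mathbf v$ satisfies $\mathbf v\preceq_0A\mathbf x$. Furthermore, if $A$ is $\mathcal A_0$-cancellative in the sense that $A\mathbf y\in\mathcal A_0^{(n)}$ implies $\mathbf y\in\mathcal A_0^{(n)}$, and if $\mathbf v\preceq_0A\mathbf x'$, then $\mathbf x\,\nabla_{(-)}\,\mathbf x'$.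
   Context: $\mathcal T$ is a commutative multiplicative monoid with unit $1$, $\mathcal T_0=\mathcal T\cup\{0\}$. A semiring satisfies all ring axioms except existence of additive inverses ($0$ additively neutral and multiplicatively absorbing). A $\mathcal T$-semiring triple $(\mathcal A,\mathcal A_0,(-))$ consists of a semiring $\mathcal A$ containing $\mathcal T_0$, with $\mathcal T$ a multiplicative submonoid not containing $0$ acting by multiplication and $\mathcal T_0$ spanning $(\mathcal A,+)$ (so $\mathcal A$ is commutative); an additive sub-semigroup $\mathcal A_0\ni0$ closed under multiplication by $\mathcal T$, with $\mathcal A_0\cap\mathcal T_0=\{0\}$; and a negation map $(-)$: an automorphism of $(\mathcal A,+,0)$ of order $\le2$ leaving $\mathcal T$ invariant, with $1+((-)1)\in\mathcal A_0$ and $((-)a)b=(-)(ab)=a((-)b)$ for $a\in\mathcal T$, $b\in\mathcal A$. Write $b(-)b'=b+((-)b')$. Standing assumptions: for $a\in\mathcal T$, $ab\in\mathcal A_0$ implies $b\in\mathcal A_0$; $ab_1=ab_2$ implies $b_1=b_2$; and Property N: $a_1+a_2=a_1(-)a_1$ whenever $a_1,a_2\in\mathcal T$ and $a_1+a_2\in\mathcal A_0$. $b\preceq_0b'$ means $b'=b+c$ for some $c\in\mathcal A_0$; $b_1\nabla_{(-)}b_2$ means $b_1(-)b_2\in\mathcal A_0$; both are defined componentwise on vectors. A tangible vector is a nonzero vector with entries in $\mathcal T_0$; tangible elements are those of $\mathcal T$. $|A|=\sum_{\pi\in S_n}(-)^\pi a_{\pi(1),1}\cdots a_{\pi(n),n}$,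 with $(-)^\pi$ the identity for even $\pi$ and $(-)$ for odd $\pi$. $\operatorname{adj}(A)$ has $(i,j)$ entry $(-)^{i+j}$ applied to the determinant of the matrix obtained from $A$ by deleting row $j$ and column $i$, where $(-)^k$ is the identity for $k$ even and $(-)$ for $k$ odd. *)

theory Defs
  imports "Jordan_Normal_Form.Determinant"
begin

(* The semiring is the whole type 'a.  It may be taken commutative because it is additively
   spanned by the commutative submonoid T, and 0 \<noteq> 1 because 1 \<in> T and 0 \<notin> T. *)

locale semiring_triple =
  fixes T A0 :: "'a::comm_semiring_1 set"
    and neg :: "'a \<Rightarrow> 'a"
  assumes one_in_T: "1 \<in> T"
    and T_mult_closed: "a \<in> T \<Longrightarrow> b \<in> T \<Longrightarrow> a * b \<in> T"
    and zero_notin_T: "0 \<notin> T"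
    and T0_spans: "\<exists>xs. set xs \<subseteq> insert 0 T \<and> b = sum_list xs"
    and zero_in_A0: "0 \<in> A0"
    and A0_add_closed: "c \<in> A0 \<Longrightarrow> d \<in> A0 \<Longrightarrow> c + d \<in> A0"
    and A0_T_closed: "a \<in> T \<Longrightarrow> c \<in> A0 \<Longrightarrow> a * c \<in> A0"
    and A0_inter_T0: "A0 \<inter> insert 0 T = {0}"
    and neg_zero: "neg 0 = 0"
    and neg_add: "neg (b + b') = neg b + neg b'"
    and neg_neg: "neg (neg b) = b"
    and neg_T: "a \<in> T \<Longrightarrow> neg a \<in> T"
    and one_neg_one: "1 + neg 1 \<in> A0"
    and neg_mult_left: "a \<in> T \<Longrightarrow> neg a * b = neg (a * b)"
    and neg_mult_right: "a \<in> T \<Longrightarrow> a * neg b = neg (a * b)"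

locale standing_semiring_triple = semiring_triple +
  assumes A0_reflect: "a \<in> T \<Longrightarrow> a * b \<in> A0 \<Longrightarrow> b \<in> A0"
    and T_cancel: "a \<in> T \<Longrightarrow> a * b1 = a * b2 \<Longrightarrow> b1 = b2"
    and property_N: "a1 \<in> T \<Longrightarrow> a2 \<in> T \<Longrightarrow> a1 + a2 \<in> A0 \<Longrightarrow> a1 + a2 = a1 + neg a1"

definition prec0 :: "'a::comm_semiring_1 set \<Rightarrow> 'a \<Rightarrow> 'a \<Rightarrow> bool" where
  "prec0 A0 b b' \<longleftrightarrow> (\<exists>c\<in>A0. b' = b + c)"

definition nabla :: "'a::comm_semiring_1 set \<Rightarrow> ('a \<Rightarrow> 'a) \<Rightarrow> 'a \<Rightarrow> 'a \<Rightarrow> bool" where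
  "nabla A0 neg b1 b2 \<longleftrightarrow> b1 + neg b2 \<in> A0"

definition vec_prec0 :: "'a::comm_semiring_1 set \<Rightarrow> 'a vec \<Rightarrow> 'a vec \<Rightarrow> bool" where
  "vec_prec0 A0 v w \<longleftrightarrow> dim_vec v = dim_vec w \<and> (\<forall>i<dim_vec v. prec0 A0 (v $ i) (w $ i))"

definition vec_nabla :: "'a::comm_semiring_1 set \<Rightarrow> ('a \<Rightarrow> 'a) \<Rightarrow> 'a vec \<Rightarrow> 'a vec \<Rightarrow> bool" where
  "vec_nabla A0 neg v w \<longleftrightarrow>
     dim_vec v = dim_vec w \<and> (\<forall>i<dim_vec v. nabla A0 neg (v $ i) (w $ i))"

definition tangible_vec :: "'a::comm_semiring_1 set \<Rightarrow> 'a vec \<Rightarrow> bool" where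
  "tangible_vec T v \<longleftrightarrow> v \<noteq> 0\<^sub>v (dim_vec v) \<and> (\<forall>i<dim_vec v. v $ i \<in> insert 0 T)"

definition A0_vec :: "'a::comm_semiring_1 set \<Rightarrow> 'a vec \<Rightarrow> bool" where
  "A0_vec A0 v \<longleftrightarrow> (\<forall>i<dim_vec v. v $ i \<in> A0)"

definition A0_cancellative :: "'a::comm_semiring_1 set \<Rightarrow> 'a mat \<Rightarrow> bool" where
  "A0_cancellative A0 A \<longleftrightarrow>
     (\<forall>y\<in>carrier_vec (dim_col A). A0_vec A0 (A *\<^sub>v y) \<longrightarrow> A0_vec A0 y)"

(* The library determinant and adjugate live over rings; here the signs are applications of neg. *)

definition triple_det :: "('a \<Rightarrow> 'a) \<Rightarrow> 'a::comm_semiring_1 mat \<Rightarrow> 'a" where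
  "triple_det neg A =
     (\<Sum>\<pi> | \<pi> permutes {0..<dim_row A}.
        (if evenperm \<pi> then id else neg) (\<Prod>i = 0..<dim_row A. A $$ (\<pi> i, i)))"

(* Indices start at 0, which leaves the parity of i + j unchanged.
   mat_delete A j i deletes row j and column i. *)
definition triple_adj :: "('a \<Rightarrow> 'a) \<Rightarrow> 'a::comm_semiring_1 mat \<Rightarrow> 'a mat" where
  "triple_adj neg A =
     mat (dim_col A) (dim_row A)
       (\<lambda>(i, j). (if even (i + j) then id else neg) (triple_det neg (mat_delete A j i)))"

end

theory Submission
  imports Defs
begin

text \<open>
  The negation map is multiplication by the fixed element \<open>neg 1\<close>, whose square is \<open>1\<close>, and,
  because \<open>T\<close> spans the semiring, the set \<open>A0\<close> is an ideal. It contains \<open>b + neg b\<close> for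
  every \<open>b\<close>. So the determinant is the usual one with \<open>neg 1\<close> in place of \<open>-1\<close>. Two classical
  facts must be examined without subtraction.

  The Laplace expansion along a row (\<open>laplace_expansion_triple_row\<close>) only rearranges the sum
  over permutations and multiplies signs, so it is still an equality. In contrast, the
  determinant of a matrix with two equal rows need not vanish: exchanging the two rows pairs
  each even permutation with an odd one of equal product, so the terms add up to a sum of
  elements \<open>b + neg b\<close> and the determinant lies in \<open>A0\<close> (\<open>triple_det_equal_rows\<close>). Hence
  \<open>A adj(A)\<close> has \<open>|A|\<close> on its diagonal and elements of \<open>A0\<close> off it, and applying it to \<open>v\<close>
  gives \<open>|A| v\<close> plus a vector over the ideal \<open>A0\<close>. If \<open>|A|\<close> has the inverse \<open>d\<close>, this relation
  is multiplied by \<open>d\<close>. Finally, if \<open>A x\<close> and \<open>A x'\<close> both arise from \<open>v\<close> by adding elements of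
  \<open>A0\<close>, then \<open>A (x + neg x')\<close> arises from \<open>v + neg v\<close> in the same way and so lies over \<open>A0\<close>,
  and the cancellation hypothesis passes this on to \<open>x + neg x'\<close>.
\<close>

section \<open>Negation as multiplication by a unit\<close>

context semiring_triple
begin

lemma neg_eq_mult: "neg b = neg 1 * b"
  using neg_mult_left[OF one_in_T, of b] by simp

lemma neg_one_square: "neg 1 * neg 1 = 1"
  by (metis neg_eq_mult neg_neg)

text \<open>Closure under tangible factors extends to all factors because these are sums of
  tangible ones. This makes \<open>A0\<close> an ideal.\<close>

lemma A0_mult_closed:
  assumes "c \<in> A0"
  shows "b * c \<in> A0"
proof -
  have "sum_list xs * c \<in> A0" if "set xs \<subseteq> insert 0 T" for xs
    using that
  proof (induction xs)
    case Nil
    then show ?case by (simp add: zero_in_A0)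
  next
    case (Cons a xs)
    then have "a * c \<in> A0"
      using A0_T_closed[OF _ assms] zero_in_A0 by auto
    with Cons show ?case
      by (simp add: distrib_right A0_add_closed)
  qed
  then show ?thesis
    using T0_spans[of b] by blast
qed

lemma A0_sum_closed: "(\<And>i. i \<in> I \<Longrightarrow> f i \<in> A0) \<Longrightarrow> sum f I \<in> A0"
  by (induction I rule: infinite_finite_induct) (auto simp: zero_in_A0 A0_add_closed)

lemma add_neg_in_A0: "b + neg b \<in> A0"
proof -
  have "b + neg b = b * (1 + neg 1)"
    by (subst neg_eq_mult) (simp add: algebra_simps)
  then show ?thesis
    using A0_mult_closed[OF one_neg_one] by simp
qed

text \<open>The analogue of \<open>(-1) ^ k\<close>, indexed by whether \<open>k\<close> is even, so that the parities of
  permutations and of index sums can be treated alike.\<close>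

definition unit_sign :: "bool \<Rightarrow> 'a" where
  "unit_sign b = (if b then 1 else neg 1)"

lemma apply_sign: "(if b then id else neg) x = unit_sign b * x"
  by (auto simp: unit_sign_def neg_eq_mult[of x])

lemma unit_sign_mult: "unit_sign b * unit_sign c = unit_sign (b = c)"
  by (auto simp: unit_sign_def neg_one_square)

lemma triple_det_unit_sign:
  assumes "B \<in> carrier_mat n n"
  shows "triple_det neg B =
    (\<Sum>\<pi> | \<pi> permutes {0..<n}. unit_sign (evenperm \<pi>) * (\<Prod>j = 0..<n. B $$ (\<pi> j, j)))"
  using assms by (simp add: triple_det_def apply_sign)

end

section \<open>Determinants up to the ideal\<close>

lemma evenperm_permutation_insert:
  assumes "q permutes {0..<n}" "i < Suc n" "j < Suc n"
  shows "evenperm (permutation_insert i j q) \<longleftrightarrow> (even (i + j) = evenperm q)"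
  using signof_permutation_insert[OF assms, where 'a = int]
  by (cases "even (i + j)") (auto simp: sign_def split: if_splits)

lemma prod_permutation_insert:
  fixes B :: "'a::comm_monoid_mult mat"
  assumes B: "B \<in> carrier_mat (Suc n) (Suc n)" and r: "r < Suc n" and j: "j < Suc n"
    and q: "q permutes {0..<n}"
  shows "(\<Prod>k = 0..<Suc n. B $$ (permutation_insert j r q k, k)) =
    B $$ (r, j) * (\<Prod>k = 0..<n. mat_delete B r j $$ (q k, k))"
proof -
  let ?p = "permutation_insert j r q"
  have "(\<Prod>k = 0..<Suc n. B $$ (?p k, k)) = B $$ (?p j, j) * (\<Prod>k\<in>{0..<Suc n} - {j}. B $$ (?p k, k))"
    using j by (intro prod.remove) auto
  also have "(\<Prod>k\<in>{0..<Suc n} - {j}. B $$ (?p k, k)) =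
      (\<Prod>k = 0..<n. B $$ (?p (insert_index j k), insert_index j k))"
    unfolding insert_index_image[OF j, symmetric]
    by (subst prod.reindex[OF insert_index_inj_on]) simp
  also have "\<dots> = (\<Prod>k = 0..<n. mat_delete B r j $$ (q k, k))"
  proof (rule prod.cong[OF refl])
    fix k assume "k \<in> {0..<n}"
    then have k: "k < n" "q k < n"
      using permutes_in_image[OF q, of k] by auto
    have "?p (insert_index j k) = insert_index r (q k)"
      by (simp add: permutation_insert_expand insert_index_def)
    then show "B $$ (?p (insert_index j k), insert_index j k) = mat_delete B r j $$ (q k, k)"
      using mat_delete_index[OF B r j k(2,1)] by simp
  qed
  finally show ?thesis by simp
qed

context semiring_triple
begin

text \<open>The terms of the determinant are grouped by the column \<open>j\<close> that the permutation sends to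
  the row \<open>r\<close>. Deleting that position turns such permutations into those of one point less and
  changes the parity by that of \<open>r + j\<close>. No terms cancel, so subtraction is never used.\<close>

lemma laplace_expansion_triple_row:
  assumes B: "B \<in> carrier_mat n n" and r: "r < n"
  shows "triple_det neg B =
    (\<Sum>j = 0..<n. B $$ (r, j) * (unit_sign (even (r + j)) * triple_det neg (mat_delete B r j)))"
proof -
  obtain m where n: "n = Suc m" using r by (cases n) auto
  let ?P = "{\<pi>. \<pi> permutes {0..<n}}"
  let ?t = "\<lambda>\<pi>. unit_sign (evenperm \<pi>) * (\<Prod>k = 0..<n. B $$ (\<pi> k, k))"
  \<comment> \<open>\<open>inv_into UNIV \<pi> r\<close> is the column in which \<open>\<pi>\<close> selects the entry of row \<open>r\<close>.\<close>
  have inner: "sum ?t {\<pi> \<in> ?P. inv_into UNIV \<pi> r = j} =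
      B $$ (r, j) * (unit_sign (even (r + j)) * triple_det neg (mat_delete B r j))"
    if "j < n" for j
  proof -
    from that n r have j: "j < Suc m" and r': "r < Suc m" by auto
    have "{\<pi> \<in> ?P. inv_into UNIV \<pi> r = j} = {\<pi>. \<pi> permutes {0..<Suc m} \<and> \<pi> j = r}"
      by (auto simp: n permutes_inv_eq)
    then have "sum ?t {\<pi> \<in> ?P. inv_into UNIV \<pi> r = j} =
        (\<Sum>q | q permutes {0..<m}. ?t (permutation_insert j r q))"
      by (simp add: permutation_fix[OF j r'] sum.reindex[OF permutation_insert_inj_on[OF j r']])
    also have "\<dots> = (\<Sum>q | q permutes {0..<m}. B $$ (r, j) * (unit_sign (even (r + j)) *
        (unit_sign (evenperm q) * (\<Prod>k = 0..<m. mat_delete B r j $$ (q k, k)))))"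
    proof (rule sum.cong[OF refl])
      fix q assume "q \<in> {q. q permutes {0..<m}}"
      then have q: "q permutes {0..<m}" by simp
      have "unit_sign (evenperm (permutation_insert j r q)) =
          unit_sign (even (r + j)) * unit_sign (evenperm q)"
        by (simp only: evenperm_permutation_insert[OF q j r'] unit_sign_mult add.commute)
      then show "?t (permutation_insert j r q) = B $$ (r, j) * (unit_sign (even (r + j)) *
          (unit_sign (evenperm q) * (\<Prod>k = 0..<m. mat_delete B r j $$ (q k, k))))"
        unfolding n prod_permutation_insert[OF B[unfolded n] r' j q]
        by (simp only: ac_simps)
    qed
    also have "\<dots> = B $$ (r, j) * (unit_sign (even (r + j)) * triple_det neg (mat_delete B r j))"
    proof -
      have "mat_delete B r j \<in> carrier_mat m m"
        using mat_delete_carrier[OF B[unfolded n], of r j] by simp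
      then show ?thesis
        by (simp add: triple_det_unit_sign sum_distrib_left)
    qed
    finally show ?thesis .
  qed
  have "triple_det neg B = sum ?t ?P"
    by (rule triple_det_unit_sign[OF B])
  also have "\<dots> = (\<Sum>j = 0..<n. sum ?t {\<pi> \<in> ?P. inv_into UNIV \<pi> r = j})"
  proof (rule sum.group[symmetric])
    show "(\<lambda>\<pi>. inv_into UNIV \<pi> r) ` ?P \<subseteq> {0..<n}"
      using r permutes_in_image[OF permutes_inv] by fastforce
  qed (simp_all add: finite_permutations)
  also have "\<dots> = (\<Sum>j = 0..<n.
      B $$ (r, j) * (unit_sign (even (r + j)) * triple_det neg (mat_delete B r j)))"
    by (intro sum.cong refl inner) simp
  finally show ?thesis .
qed

text \<open>Composition with the transposition of the two rows matches the odd permutations with the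
  even ones and preserves the product of entries. In a ring the two terms cancel; here they add
  up to an element \<open>b + neg b\<close>.\<close>

lemma triple_det_equal_rows:
  assumes B: "B \<in> carrier_mat n n" and i: "i < n" and r: "r < n" and ne: "i \<noteq> r"
    and eq: "\<And>j. j < n \<Longrightarrow> B $$ (i, j) = B $$ (r, j)"
  shows "triple_det neg B \<in> A0"
proof -
  let ?P = "{\<pi>. \<pi> permutes {0..<n}}"
  let ?E = "{\<pi> \<in> ?P. evenperm \<pi>}" and ?O = "{\<pi> \<in> ?P. \<not> evenperm \<pi>}"
  let ?b = "\<lambda>\<pi>. \<Prod>k = 0..<n. B $$ (\<pi> k, k)"
  let ?\<tau> = "transpose i r"
  have \<tau>: "?\<tau> permutes {0..<n}"
    using i r by (intro permutes_swap_id) auto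
  have parity: "evenperm (?\<tau> \<circ> \<pi>) \<longleftrightarrow> \<not> evenperm \<pi>" if "\<pi> permutes {0..<n}" for \<pi>
    using that \<tau> ne permutation_permutes
    by (subst evenperm_comp) (auto simp: evenperm_swap)
  have product: "?b (?\<tau> \<circ> \<pi>) = ?b \<pi>" for \<pi>
    by (intro prod.cong refl) (auto simp: transpose_def eq)
  have bij: "bij_betw (\<lambda>\<pi>. ?\<tau> \<circ> \<pi>) ?E ?O"
    by (rule bij_betw_byWitness[where f' = "\<lambda>\<pi>. ?\<tau> \<circ> \<pi>"])
      (auto simp: parity permutes_compose[OF _ \<tau>] o_assoc)
  have "triple_det neg B = (\<Sum>\<pi>\<in>?P. unit_sign (evenperm \<pi>) * ?b \<pi>)"
    by (rule triple_det_unit_sign[OF B])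
  also have "\<dots> = (\<Sum>\<pi>\<in>?E \<union> ?O. unit_sign (evenperm \<pi>) * ?b \<pi>)"
    by (rule sum.cong) auto
  also have "\<dots> = (\<Sum>\<pi>\<in>?E. unit_sign (evenperm \<pi>) * ?b \<pi>) + (\<Sum>\<pi>\<in>?O. unit_sign (evenperm \<pi>) * ?b \<pi>)"
    by (rule sum.union_disjoint) (auto simp: finite_permutations)
  also have "(\<Sum>\<pi>\<in>?E. unit_sign (evenperm \<pi>) * ?b \<pi>) = sum ?b ?E"
    by (rule sum.cong) (auto simp: unit_sign_def)
  also have "(\<Sum>\<pi>\<in>?O. unit_sign (evenperm \<pi>) * ?b \<pi>) = (\<Sum>\<pi>\<in>?O. neg (?b \<pi>))"
    by (rule sum.cong) (auto simp: unit_sign_def simp flip: neg_eq_mult)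
  also have "\<dots> = (\<Sum>\<pi>\<in>?E. neg (?b (?\<tau> \<circ> \<pi>)))"
    by (rule sum.reindex_bij_betw[OF bij, symmetric])
  also have "\<dots> = (\<Sum>\<pi>\<in>?E. neg (?b \<pi>))"
    by (simp only: product)
  also have "sum ?b ?E + \<dots> = (\<Sum>\<pi>\<in>?E. ?b \<pi> + neg (?b \<pi>))"
    by (simp add: sum.distrib)
  finally show ?thesis
    by (simp add: A0_sum_closed add_neg_in_A0)
qed

end

section \<open>The product with the adjugate\<close>

context semiring_triple
begin

lemma triple_adj_carrier: "A \<in> carrier_mat n n \<Longrightarrow> triple_adj neg A \<in> carrier_mat n n"
  by (auto simp: triple_adj_def)

lemma mult_triple_adj_index:
  assumes A: "A \<in> carrier_mat n n" and i: "i < n" and k: "k < n"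
  shows "(A * triple_adj neg A) $$ (i, k) =
    (\<Sum>j = 0..<n. A $$ (i, j) * (unit_sign (even (k + j)) * triple_det neg (mat_delete A k j)))"
  using A i k triple_adj_carrier[OF A]
  by (auto simp: scalar_prod_def triple_adj_def apply_sign add.commute intro!: sum.cong)

lemma mult_triple_adj_diagonal:
  assumes "A \<in> carrier_mat n n" "i < n"
  shows "(A * triple_adj neg A) $$ (i, i) = triple_det neg A"
  using assms by (simp only: mult_triple_adj_index laplace_expansion_triple_row)

text \<open>The cofactors of row \<open>k\<close> ignore the entries of that row, so weighting them with the
  entries of row \<open>i\<close> expands the determinant of \<open>A\<close> with row \<open>k\<close> overwritten by row \<open>i\<close>.\<close>

lemma mult_triple_adj_off_diagonal:
  assumes A: "A \<in> carrier_mat n n" and i: "i < n" and k: "k < n" and ne: "i \<noteq> k"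
  shows "(A * triple_adj neg A) $$ (i, k) \<in> A0"
proof -
  define B where "B = mat n n (\<lambda>(r, j). A $$ (if r = k then i else r, j))"
  have B: "B \<in> carrier_mat n n" by (simp add: B_def)
  have "mat_delete B k j = mat_delete A k j" if "j < n" for j
    using A that by (auto simp: B_def mat_delete_def intro!: cong_mat)
  then have "(A * triple_adj neg A) $$ (i, k) = triple_det neg B"
    unfolding mult_triple_adj_index[OF A i k] laplace_expansion_triple_row[OF B k]
    using k i by (intro sum.cong) (auto simp: B_def)
  moreover have "triple_det neg B \<in> A0"
    by (rule triple_det_equal_rows[OF B i k ne]) (use i k in \<open>simp add: B_def\<close>)
  ultimately show ?thesis by simp
qed

lemma triple_det_smult_prec0:
  assumes A: "A \<in> carrier_mat n n" and v: "v \<in> carrier_vec n"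
  shows "vec_prec0 A0 (triple_det neg A \<cdot>\<^sub>v v) (A *\<^sub>v (triple_adj neg A *\<^sub>v v))"
proof -
  let ?C = "A * triple_adj neg A"
  have C: "?C \<in> carrier_mat n n" using A triple_adj_carrier[OF A] by simp
  have "prec0 A0 (triple_det neg A * v $ i) ((?C *\<^sub>v v) $ i)" if i: "i < n" for i
  proof -
    have "(?C *\<^sub>v v) $ i = (\<Sum>k = 0..<n. ?C $$ (i, k) * v $ k)"
      using C v i by (simp add: scalar_prod_def carrier_matD[OF C] del: index_mult_mat assoc_mult_mat_vec)
    also have "\<dots> = ?C $$ (i, i) * v $ i + (\<Sum>k\<in>{0..<n} - {i}. ?C $$ (i, k) * v $ k)"
      using i by (intro sum.remove) auto
    also have "?C $$ (i, i) = triple_det neg A"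
      by (rule mult_triple_adj_diagonal[OF A i])
    finally have expand: "(?C *\<^sub>v v) $ i =
        triple_det neg A * v $ i + (\<Sum>k\<in>{0..<n} - {i}. ?C $$ (i, k) * v $ k)" .
    have "(\<Sum>k\<in>{0..<n} - {i}. ?C $$ (i, k) * v $ k) \<in> A0"
    proof (rule A0_sum_closed)
      fix k assume "k \<in> {0..<n} - {i}"
      then have "?C $$ (i, k) \<in> A0"
        by (intro mult_triple_adj_off_diagonal[OF A i]) auto
      then show "?C $$ (i, k) * v $ k \<in> A0"
        by (subst mult.commute) (rule A0_mult_closed)
    qed
    with expand show ?thesis unfolding prec0_def by blast
  qed
  then have "vec_prec0 A0 (triple_det neg A \<cdot>\<^sub>v v) (?C *\<^sub>v v)"
    using A v by (simp add: vec_prec0_def)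
  then show ?thesis
    by (simp only: assoc_mult_mat_vec[OF A triple_adj_carrier[OF A] v])
qed

lemma vec_prec0_smult:
  assumes "vec_prec0 A0 v w"
  shows "vec_prec0 A0 (d \<cdot>\<^sub>v v) (d \<cdot>\<^sub>v w)"
proof -
  have "prec0 A0 (d * b) (d * b')" if "prec0 A0 b b'" for b b'
    using that A0_mult_closed unfolding prec0_def by (metis distrib_left)
  then show ?thesis
    using assms by (simp add: vec_prec0_def)
qed

text \<open>The difference of \<open>v + c\<close> and \<open>v + c'\<close> is \<open>v + neg v\<close> up to elements of \<open>A0\<close>, and
  \<open>v + neg v\<close> lies in \<open>A0\<close> although it need not be \<open>0\<close>.\<close>

lemma prec0_imp_nabla:
  assumes "prec0 A0 v w" "prec0 A0 v w'"
  shows "nabla A0 neg w w'"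
proof -
  from assms obtain c c' where c: "c \<in> A0" "w = v + c" and c': "c' \<in> A0" "w' = v + c'"
    unfolding prec0_def by blast
  have "neg c' \<in> A0"
    by (subst neg_eq_mult) (rule A0_mult_closed[OF c'(1)])
  moreover have "w + neg w' = (v + neg v) + (c + neg c')"
    by (simp add: c c' neg_add ac_simps)
  ultimately show ?thesis
    using c(1) by (simp add: nabla_def A0_add_closed add_neg_in_A0)
qed

end

section \<open>Uniqueness up to the ideal\<close>

lemma mult_mat_smult_vec:
  fixes d :: "'a::comm_semiring_0"
  assumes "A \<in> carrier_mat m n" "w \<in> carrier_vec n"
  shows "A *\<^sub>v (d \<cdot>\<^sub>v w) = d \<cdot>\<^sub>v (A *\<^sub>v w)"
  using assms by (intro eq_vecI) (auto simp: scalar_prod_def sum_distrib_left ac_simps)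

context semiring_triple
begin

text \<open>The hypothesis on \<open>A\<close> is applied to \<open>x + neg x'\<close>. Writing this vector as
  \<open>x + neg 1 \<cdot>\<^sub>v x'\<close> lets matrix multiplication distribute over it by linearity.\<close>

lemma A0_cancellative_unique:
  assumes A: "A \<in> carrier_mat n n" and cancel: "A0_cancellative A0 A"
    and x: "x \<in> carrier_vec n" "vec_prec0 A0 v (A *\<^sub>v x)"
    and x': "x' \<in> carrier_vec n" "vec_prec0 A0 v (A *\<^sub>v x')"
  shows "vec_nabla A0 neg x x'"
proof -
  let ?y = "x + neg 1 \<cdot>\<^sub>v x'"
  have y: "?y \<in> carrier_vec n" using x x' by simp
  have Ay: "A *\<^sub>v ?y = A *\<^sub>v x + neg 1 \<cdot>\<^sub>v (A *\<^sub>v x')"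
    using A x x' by (simp add: mult_add_distrib_mat_vec mult_mat_smult_vec)
  have "nabla A0 neg ((A *\<^sub>v x) $ i) ((A *\<^sub>v x') $ i)" if "i < n" for i
    using x(2) x'(2) A that by (intro prec0_imp_nabla[of "v $ i"]) (auto simp: vec_prec0_def)
  then have "A0_vec A0 (A *\<^sub>v ?y)"
    unfolding Ay using A by (auto simp: A0_vec_def nabla_def neg_eq_mult[of "_ \<bullet> _"])
  then have "A0_vec A0 ?y"
    using cancel y A by (auto simp: A0_cancellative_def)
  then show ?thesis
    using x(1) x'(1) by (auto simp: A0_vec_def vec_nabla_def nabla_def neg_eq_mult[of "x' $ _"])
qed

end

theorem theorem12:
  fixes T A0 :: "'a::comm_semiring_1 set" and neg :: "'a \<Rightarrow> 'a"
    and A :: "'a mat" and v :: "'a vec" and n :: nat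
  assumes "standing_semiring_triple T A0 neg"
    and "A \<in> carrier_mat n n"
    and "v \<in> carrier_vec n"
  shows "vec_prec0 A0 (triple_det neg A \<cdot>\<^sub>v v) (A *\<^sub>v (triple_adj neg A *\<^sub>v v)) \<and>
    (\<forall>d x. triple_det neg A \<in> T \<longrightarrow> triple_det neg A * d = 1 \<longrightarrow>
        tangible_vec T (triple_adj neg A *\<^sub>v v) \<longrightarrow>
        x = d \<cdot>\<^sub>v (triple_adj neg A *\<^sub>v v) \<longrightarrow>
        vec_prec0 A0 v (A *\<^sub>v x) \<and>
        (A0_cancellative A0 A \<longrightarrow>
          (\<forall>x'\<in>carrier_vec n. vec_prec0 A0 v (A *\<^sub>v x') \<longrightarrow> vec_nabla A0 neg x x')))"
proof -
  interpret standing_semiring_triple T A0 neg by fact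
  note A = assms(2) and v = assms(3)
  let ?w = "triple_adj neg A *\<^sub>v v"
  have w: "?w \<in> carrier_vec n" using triple_adj_carrier[OF A] v by simp
  note main = triple_det_smult_prec0[OF A v]
  have solves: "vec_prec0 A0 v (A *\<^sub>v (d \<cdot>\<^sub>v ?w))" if "triple_det neg A * d = 1" for d
  proof -
    have "d \<cdot>\<^sub>v (triple_det neg A \<cdot>\<^sub>v v) = v"
    proof (rule eq_vecI)
      fix i assume "i < dim_vec v"
      then have "(d \<cdot>\<^sub>v (triple_det neg A \<cdot>\<^sub>v v)) $ i = triple_det neg A * d * v $ i"
        by (simp add: mult.left_commute mult.assoc)
      with that show "(d \<cdot>\<^sub>v (triple_det neg A \<cdot>\<^sub>v v)) $ i = v $ i"
        by simp
    qed simp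
    with vec_prec0_smult[OF main, of d] show ?thesis
      by (simp add: mult_mat_smult_vec[OF A w])
  qed
  show ?thesis
    using main solves A0_cancellative_unique[OF A _ smult_carrier_vec[THEN iffD2, OF w] solves]
    by blast
qed

end
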